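(* Each segment of a 1-parameter subgroup $$\gamma(t)=\exp(tX),\quad t\in\mathbb{R},\quad X\in H_0,\quad (X,X)=1,$$ is a shortest arc of the sub-Riemannian space $(\mathrm{SL}(2,\mathbb{C}),\rho)$.
   Context: Let $e_1=\frac12\begin{pmatrix}0&1\\1&0\end{pmatrix}$, $e_2=\frac12\begin{pmatrix}0&\mathbf{i}\\-\mathbf{i}&0\end{pmatrix}$, $e_3=\frac12\begin{pmatrix}1&0\\0&-1\end{pmatrix}$, $e_4=\mathbf{i}e_1$, $e_5=\mathbf{i}e_2$, $e_6=\mathbf{i}e_3$; these form a real basis of the Lie algebra $\mathfrak{sl}(2,\mathbb{C})$, and $(\cdot,\cdot)$ is the scalar product on $\mathfrak{sl}(2,\mathbb{C})$ for which this basis is orthonormal. $H_0=\mathrm{span}_{\mathbb{R}}(e_1,e_2,e_3)$ is the space of traceless Hermitian $2\times2$ matrices. The left-invariant sub-Riemannian metric $\rho$ on $\mathrm{SL}(2,\mathbb{C})$ is defined as follows: $\rho(x,y)$ is the infimum of the lengths $\int_0^a\sqrt{(u(t),u(t))}\,dt$ of piecewise continuously differentiable paths $\gamma(t)$, $0\le t\le a$, from $x$ to $y$ with $\gamma'(t)=dl_{\gamma(t)}(u(t))$, $u(t)\in H_0$ (horizontal paths), where $l_g:h\mapsto gh$. A shortest arc is a horizontal curve whose length equals the $\rho$-distance between its endpoints. *)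

theory Defs
  imports "HOL-Analysis.Analysis"
begin

type_synonym cmat2 = "complex^2^2"

(* On the type cmat2 the class operations * and ^ act entrywise, so the matrix product is
   always ** below, and the exponential cannot be the overloaded exp. *)

definition mat_exp :: "cmat2 \<Rightarrow> cmat2" where
  "mat_exp X = (\<Sum>n. (1 / fact n) *\<^sub>R (((**) X ^^ n) (mat 1)))"

definition SL2C :: "cmat2 set" where
  "SL2C = {g. det g = 1}"

definition mat_cscale :: "complex \<Rightarrow> cmat2 \<Rightarrow> cmat2" where
  "mat_cscale c A = (\<chi> i j. c * A $ i $ j)"

definition e1 :: cmat2 where
  "e1 = (1/2) *\<^sub>R vector [vector [0, 1], vector [1, 0]]"

definition e2 :: cmat2 where
  "e2 = (1/2) *\<^sub>R vector [vector [0, \<i>], vector [-\<i>, 0]]"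

definition e3 :: cmat2 where
  "e3 = (1/2) *\<^sub>R vector [vector [1, 0], vector [0, -1]]"

definition e4 :: cmat2 where "e4 = mat_cscale \<i> e1"
definition e5 :: cmat2 where "e5 = mat_cscale \<i> e2"
definition e6 :: cmat2 where "e6 = mat_cscale \<i> e3"

definition sl2_basis :: "cmat2 set" where
  "sl2_basis = {e1, e2, e3, e4, e5, e6}"

(* The real scalar product making sl2_basis orthonormal; it is meaningful only on
   span sl2_basis, i.e. on the traceless matrices.  It is not the inner product of the
   type cmat2: it is twice that (see sl2_inner_eq). *)
definition sl2_inner :: "cmat2 \<Rightarrow> cmat2 \<Rightarrow> real" where
  "sl2_inner X Y =
     (\<Sum>b\<in>sl2_basis. representation sl2_basis X b * representation sl2_basis Y b)"

definition H0 :: "cmat2 set" where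
  "H0 = span {e1, e2, e3}"

(* Continuously differentiable on each closed piece of a finite subdivision, with one-sided
   derivatives at the break points.  The library's piecewise_C1_differentiable_on puts no
   condition on the derivative near break points, so it would admit unbounded speed, and the
   length integral could fail to exist. *)

definition C1_on_interval :: "real \<Rightarrow> real \<Rightarrow> (real \<Rightarrow> cmat2) \<Rightarrow> bool" where
  "C1_on_interval c d \<gamma> \<longleftrightarrow>
     (\<exists>D. continuous_on {c..d} D \<and>
          (\<forall>t\<in>{c..d}. (\<gamma> has_vector_derivative D t) (at t within {c..d})))"

definition piecewise_C1_path :: "real \<Rightarrow> real \<Rightarrow> (real \<Rightarrow> cmat2) \<Rightarrow> bool" where
  "piecewise_C1_path a b \<gamma> \<longleftrightarrow>
     (\<exists>(n::nat) p. p 0 = a \<and> p n = b \<and>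
        (\<forall>i<n. p i < p (Suc i) \<and> C1_on_interval (p i) (p (Suc i)) \<gamma>))"

(* As l_g is the restriction to SL(2,C) of the linear map h |-> g ** h, its differential sends
   u to g ** u.  At finitely many parameters (the break points) the derivative of the path need
   not exist.  Away from them u t is determined by the path. *)
definition horizontal_path ::
    "real \<Rightarrow> real \<Rightarrow> (real \<Rightarrow> cmat2) \<Rightarrow> (real \<Rightarrow> cmat2) \<Rightarrow> bool" where
  "horizontal_path a b \<gamma> u \<longleftrightarrow>
     piecewise_C1_path a b \<gamma> \<and>
     (\<forall>t\<in>{a..b}. \<gamma> t \<in> SL2C) \<and>
     (\<forall>t\<in>{a..b}. u t \<in> H0) \<and>
     (\<exists>N. finite N \<and>
        (\<forall>t\<in>{a..b} - N. (\<gamma> has_vector_derivative \<gamma> t ** u t) (at t within {a..b})))"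

definition sr_length :: "real \<Rightarrow> real \<Rightarrow> (real \<Rightarrow> cmat2) \<Rightarrow> real" where
  "sr_length a b u = integral {a..b} (\<lambda>t. sqrt (sl2_inner (u t) (u t)))"

(* An infimum of reals: the set is bounded below by 0 and nonempty for x, y in SL2C, since H0
   generates the Lie algebra under brackets.  That a >= 0 is part of horizontal_path. *)
definition sr_dist :: "cmat2 \<Rightarrow> cmat2 \<Rightarrow> real" where
  "sr_dist x y =
     Inf {sr_length 0 a u | a \<gamma> u. horizontal_path 0 a \<gamma> u \<and> \<gamma> 0 = x \<and> \<gamma> a = y}"

definition shortest_arc :: "real \<Rightarrow> real \<Rightarrow> (real \<Rightarrow> cmat2) \<Rightarrow> bool" where
  "shortest_arc a b \<gamma> \<longleftrightarrow>
     (\<exists>u. horizontal_path a b \<gamma> u \<and> sr_length a b u = sr_dist (\<gamma> a) (\<gamma> b))"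


lemmas basis_defs = e1_def e2_def e3_def e4_def e5_def e6_def mat_cscale_def

lemma basis_entries:
  "e1 $ 1 $ 1 = 0" "e1 $ 1 $ 2 = 1/2" "e1 $ 2 $ 1 = 1/2" "e1 $ 2 $ 2 = 0"
  "e2 $ 1 $ 1 = 0" "e2 $ 1 $ 2 = \<i>/2" "e2 $ 2 $ 1 = -\<i>/2" "e2 $ 2 $ 2 = 0"
  "e3 $ 1 $ 1 = 1/2" "e3 $ 1 $ 2 = 0" "e3 $ 2 $ 1 = 0" "e3 $ 2 $ 2 = -1/2"
  "e4 $ 1 $ 1 = 0" "e4 $ 1 $ 2 = \<i>/2" "e4 $ 2 $ 1 = \<i>/2" "e4 $ 2 $ 2 = 0"
  "e5 $ 1 $ 1 = 0" "e5 $ 1 $ 2 = -1/2" "e5 $ 2 $ 1 = 1/2" "e5 $ 2 $ 2 = 0"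
  "e6 $ 1 $ 1 = \<i>/2" "e6 $ 1 $ 2 = 0" "e6 $ 2 $ 1 = 0" "e6 $ 2 $ 2 = -\<i>/2"
  by (simp_all add: basis_defs complex_eq_iff)

lemma inner_cmat2:
  fixes X Y :: cmat2
  shows "X \<bullet> Y = X$1$1 \<bullet> Y$1$1 + X$1$2 \<bullet> Y$1$2 + X$2$1 \<bullet> Y$2$1 + X$2$2 \<bullet> Y$2$2"
  by (simp add: inner_vec_def sum_2)

lemma cmat2_eq_iff:
  fixes X Y :: cmat2
  shows "X = Y \<longleftrightarrow> X$1$1 = Y$1$1 \<and> X$1$2 = Y$1$2 \<and> X$2$1 = Y$2$1 \<and> X$2$2 = Y$2$2"
  by (auto simp: vec_eq_iff forall_2)

lemma inner_basis:
  assumes "b \<in> sl2_basis" "c \<in> sl2_basis"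
  shows "2 * (b \<bullet> c) = (if b = c then 1 else 0)"
  using assms unfolding sl2_basis_def
  by (elim insertE emptyE; simp only:)
     (simp_all add: inner_cmat2 cmat2_eq_iff basis_entries inner_complex_def complex_eq_iff)

lemma independent_sl2_basis: "independent sl2_basis"
proof (rule pairwise_orthogonal_independent)
  show "pairwise orthogonal sl2_basis"
    unfolding pairwise_def orthogonal_def using inner_basis by fastforce
  show "0 \<notin> sl2_basis"
    using inner_basis[of 0 0] by auto
qed

lemma sl2_inner_basis:
  assumes "b \<in> sl2_basis" "c \<in> sl2_basis"
  shows "sl2_inner b c = (if b = c then 1 else 0)"
proof -
  have "sl2_inner b c = (\<Sum>d\<in>sl2_basis. if d = b then (if b = c then 1 else 0) else 0)"
    unfolding sl2_inner_def
    by (intro sum.cong refl) (simp add: assms representation_basis[OF independent_sl2_basis])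
  also have "\<dots> = (if b = c then 1 else 0)"
    using assms(1) by (simp add: sl2_basis_def)
  finally show ?thesis .
qed

lemma card_sl2_basis: "card sl2_basis = 6"
  unfolding sl2_basis_def
  by (simp add: cmat2_eq_iff basis_entries complex_eq_iff)

lemma span_sl2_basis: "span sl2_basis = {X. trace X = 0}"
proof
  have "subspace {X::cmat2. trace X = 0}"
    by (auto simp: subspace_def trace_def sum_2 add_eq_0_iff simp flip: scaleR_right_distrib)
  moreover have "sl2_basis \<subseteq> {X. trace X = 0}"
    by (auto simp: sl2_basis_def trace_def sum_2 basis_entries)
  ultimately show "span sl2_basis \<subseteq> {X. trace X = 0}"
    by (rule span_minimal[rotated])
next
  show "{X. trace X = 0} \<subseteq> span sl2_basis"
  proof
    fix X :: cmat2 assume "X \<in> {X. trace X = 0}"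
    then have t: "X $ 2 $ 2 = - X $ 1 $ 1"
      by (simp add: trace_def sum_2 eq_neg_iff_add_eq_0 add.commute)
    have "X = (Re (X$1$2) + Re (X$2$1)) *\<^sub>R e1 + (Im (X$1$2) - Im (X$2$1)) *\<^sub>R e2
            + (2 * Re (X$1$1)) *\<^sub>R e3 + (Im (X$1$2) + Im (X$2$1)) *\<^sub>R e4
            + (Re (X$2$1) - Re (X$1$2)) *\<^sub>R e5 + (2 * Im (X$1$1)) *\<^sub>R e6"
      using t by (simp add: cmat2_eq_iff basis_entries complex_eq_iff field_simps)
    also have "\<dots> \<in> span sl2_basis"
      by (intro span_add span_scale span_base) (auto simp: sl2_basis_def)
    finally show "X \<in> span sl2_basis" .
  qed
qed

lemma sl2_inner_eq:
  assumes "trace X = 0" "trace Y = 0"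
  shows "sl2_inner X Y = 2 * (X \<bullet> Y)"
proof -
  let ?r = "representation sl2_basis"
  have fin: "finite sl2_basis" by (simp add: sl2_basis_def)
  have rep: "Z = (\<Sum>b\<in>sl2_basis. ?r Z b *\<^sub>R b)" if "trace Z = 0" for Z
    using that sum_representation_eq[OF independent_sl2_basis _ fin order_refl, of Z]
    by (simp add: span_sl2_basis)
  have "2 * (X \<bullet> Y) =
      2 * ((\<Sum>b\<in>sl2_basis. ?r X b *\<^sub>R b) \<bullet> (\<Sum>c\<in>sl2_basis. ?r Y c *\<^sub>R c))"
    using rep[OF assms(1)] rep[OF assms(2)] by metis
  also have "\<dots> = (\<Sum>b\<in>sl2_basis. \<Sum>c\<in>sl2_basis. ?r X b * ?r Y c * (2 * (b \<bullet> c)))"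
    unfolding inner_sum_left by (simp add: inner_sum_right sum_distrib_left mult_ac)
  also have "\<dots> = (\<Sum>b\<in>sl2_basis. \<Sum>c\<in>sl2_basis. if b = c then ?r X b * ?r Y c else 0)"
    by (intro sum.cong refl) (simp add: inner_basis)
  also have "\<dots> = sl2_inner X Y"
    by (simp add: sl2_inner_def fin)
  finally show ?thesis by simp
qed

lemma H0_eq:
  "H0 = {X. trace X = 0 \<and> (\<forall>i j. X $ j $ i = cnj (X $ i $ j))}" (is "_ = ?R")
proof -
  let ?S = "{X::cmat2. trace X = 0 \<and> Im (X$1$1) = 0 \<and> Im (X$2$2) = 0
              \<and> Re (X$2$1) = Re (X$1$2) \<and> Im (X$2$1) = - Im (X$1$2)}"
  have "(\<forall>i j. X $ j $ i = cnj (X $ i $ j)) \<longleftrightarrow> Im (X$1$1) = 0 \<and> Im (X$2$2) = 0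
              \<and> Re (X$2$1) = Re (X$1$2) \<and> Im (X$2$1) = - Im (X$1$2)" for X :: cmat2
    unfolding forall_2 complex_eq_iff complex_cnj by auto
  then have R: "?R = ?S" by simp
  have "H0 = ?S"
  proof
    have "subspace ?S"
      by (auto simp: subspace_def trace_def sum_2 complex_eq_iff algebra_simps
            simp flip: distrib_left)
    moreover have "{e1, e2, e3} \<subseteq> ?S"
      by (auto simp: trace_def sum_2 basis_entries)
    ultimately show "H0 \<subseteq> ?S"
      unfolding H0_def by (rule span_minimal[rotated])
  next
    show "?S \<subseteq> H0"
    proof
      fix X assume "X \<in> ?S"
      then have "X = (2 * Re (X$1$2)) *\<^sub>R e1 + (2 * Im (X$1$2)) *\<^sub>R e2 + (2 * Re (X$1$1)) *\<^sub>R e3"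
        by (simp add: trace_def sum_2 cmat2_eq_iff basis_entries complex_eq_iff)
      also have "\<dots> \<in> H0"
        unfolding H0_def by (intro span_add span_scale span_base) auto
      finally show "X \<in> H0" .
    qed
  qed
  with R show ?thesis by simp
qed

lemma summable_mat_exp: "summable (\<lambda>n. (1 / fact n) *\<^sub>R (((**) (X::cmat2) ^^ n) (mat 1)))"
proof -
  have "bounded_linear ((**) X :: cmat2 \<Rightarrow> cmat2)"
    unfolding linear_conv_bounded_linear[symmetric]
    by (rule linearI)
       (simp_all add: matrix_matrix_mult_def vec_eq_iff sum.distrib distrib_left scaleR_sum_right)
  then obtain K where K: "K > 0" "\<And>Y :: cmat2. norm (X ** Y) \<le> norm Y * K"
    using bounded_linear.pos_bounded by blast
  have le: "norm (((**) X ^^ n) (mat 1)) \<le> K ^ n * norm (mat 1 :: cmat2)" for n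
  proof (induction n)
    case (Suc n)
    have "norm (((**) X ^^ Suc n) (mat 1)) \<le> norm (((**) X ^^ n) (mat 1)) * K"
      using K(2) by simp
    also have "\<dots> \<le> (K ^ n * norm (mat 1 :: cmat2)) * K"
      using Suc K(1) by (intro mult_right_mono) auto
    finally show ?case by (simp add: mult_ac)
  qed simp
  have "summable (\<lambda>n. norm (mat 1 :: cmat2) * (inverse (fact n) * K ^ n))"
    by (intro summable_mult summable_exp)
  then show ?thesis
  proof (rule summable_comparison_test'[where N = 0])
    fix n :: nat
    show "norm ((1 / fact n) *\<^sub>R (((**) X ^^ n) (mat 1)))
        \<le> norm (mat 1 :: cmat2) * (inverse (fact n) * K ^ n)"
      using le[of n] by (simp add: field_simps)
  qed
qed

end

theory Submission
  imports Defs
begin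

text \<open>
  The lower bound comes from a function whose logarithm grows along a horizontal path at most as
  fast as arc length, and exactly as fast along the one-parameter subgroup.

  An element \<open>u\<close> of \<^term>\<open>H0\<close> is Hermitian and traceless, so by Cayley--Hamilton its square is the
  scalar \<open>\<bar>u\<bar>\<^sup>2 / 4\<close>, where \<open>\<bar>u\<bar>\<close> is the sub-Riemannian norm. Right multiplication by \<open>u\<close> is a
  self-adjoint operator on matrices with this scalar as its square, hence it stretches every
  matrix by the factor \<open>\<bar>u\<bar> / 2\<close> (\<open>norm_mult_H0\<close>). For a fixed matrix \<open>Q \<noteq> 0\<close> and a horizontal
  path with \<open>\<gamma>' = \<gamma> u\<close>, the matrix \<open>Y = Q \<gamma>\<close> satisfies \<open>Y' = Y u\<close>, and the Cauchy--Schwarz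
  inequality bounds the derivative of \<open>2 ln \<parallel>Y\<parallel>\<close> by \<open>\<bar>u\<bar>\<close>. Integration shows that the length of
  the path is at least the growth of \<open>2 ln \<parallel>Q \<gamma>\<parallel>\<close> (\<open>log_growth_le_length\<close>), a quantity that
  depends only on \<open>Q\<close> and the end points.

  A unit vector \<open>X\<close> of \<^term>\<open>H0\<close> has the eigenvalues \<open>1/2\<close> and \<open>-1/2\<close>. Taking for \<open>Q\<close> the
  spectral projection \<open>1/2 + X\<close> of the eigenvalue \<open>1/2\<close> gives \<open>Q exp (\<tau> X) = exp (\<tau>/2) Q\<close>, so
  between \<open>exp (s X)\<close> and \<open>exp (t X)\<close> the growth is exactly \<open>t - s\<close>. This is also the length of
  the segment of the one-parameter subgroup, which therefore realises the infimum
  (\<open>sr_dist_mat_exp\<close>).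
\<close>

section \<open>Matrix algebra of traceless Hermitian matrices\<close>

lemma bounded_bilinear_matrix_mult: "bounded_bilinear ((**) :: cmat2 \<Rightarrow> cmat2 \<Rightarrow> cmat2)"
  unfolding bilinear_conv_bounded_bilinear[symmetric] bilinear_def
  by (auto intro!: linearI simp: matrix_matrix_mult_def vec_eq_iff sum.distrib distrib_left
      distrib_right scaleR_sum_right)

lemmas matrix_mult_bilinear_simps =
  bounded_bilinear.add_left[OF bounded_bilinear_matrix_mult]
  bounded_bilinear.add_right[OF bounded_bilinear_matrix_mult]
  bounded_bilinear.diff_left[OF bounded_bilinear_matrix_mult]
  bounded_bilinear.diff_right[OF bounded_bilinear_matrix_mult]
  bounded_bilinear.scaleR_left[OF bounded_bilinear_matrix_mult]
  bounded_bilinear.scaleR_right[OF bounded_bilinear_matrix_mult]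

lemma matrix_mult_entry: "((A::cmat2) ** B) $ i $ j = A $ i $ 1 * B $ 1 $ j + A $ i $ 2 * B $ 2 $ j"
  by (simp add: matrix_matrix_mult_def sum_2)

lemma H0_trace: "u \<in> H0 \<Longrightarrow> trace u = 0"
  unfolding H0_eq by blast

lemma H0_entries:
  assumes "u \<in> H0"
  shows "u$2$2 = - u$1$1" "Im (u$1$1) = 0" "u$2$1 = cnj (u$1$2)"
proof -
  show "u$2$2 = - u$1$1"
    using H0_trace[OF assms] by (simp add: trace_def sum_2 eq_neg_iff_add_eq_0 add.commute)
  have hermitian: "u $ j $ i = cnj (u $ i $ j)" for i j
    using assms unfolding H0_eq by blast
  show "u$2$1 = cnj (u$1$2)"
    by (rule hermitian)
  show "Im (u$1$1) = 0"
    using arg_cong[OF hermitian[of 1 1], of Im] by (simp only: complex_cnj) simp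
qed

lemma sl2_inner_H0: "u \<in> H0 \<Longrightarrow> sl2_inner u u = 2 * (u \<bullet> u)"
  by (simp add: sl2_inner_eq H0_trace)

text \<open>Cayley--Hamilton for trace zero, with the determinant read off as minus a quarter of the
  squared norm.\<close>

lemma H0_square:
  assumes "u \<in> H0"
  shows "u ** u = (sl2_inner u u / 4) *\<^sub>R mat 1"
  using H0_entries[OF assms] sl2_inner_H0[OF assms]
  by (simp add: cmat2_eq_iff matrix_mult_entry mat_def inner_cmat2 complex_eq_iff inner_complex_def)

lemma H0_selfadjoint:
  fixes Y Z :: cmat2
  assumes "u \<in> H0"
  shows "(Y ** u) \<bullet> Z = Y \<bullet> (Z ** u)"
  using H0_entries[OF assms]
  by (simp add: inner_cmat2 matrix_mult_entry inner_complex_def algebra_simps)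

text \<open>Self-adjointness moves one factor \<open>u\<close> of \<open>\<parallel>Y u\<parallel>\<^sup>2\<close> to the other side, where it completes the
  scalar matrix \<open>u\<^sup>2\<close>. The factor \<open>1/2\<close> reflects the normalisation of the scalar product: unit
  vectors have eigenvalues of modulus \<open>1/2\<close>.\<close>

lemma norm_mult_H0:
  fixes Y :: cmat2
  assumes "u \<in> H0"
  shows "norm (Y ** u) = sqrt (sl2_inner u u) / 2 * norm Y"
proof -
  have "(Y ** u) \<bullet> (Y ** u) = sl2_inner u u / 4 * (Y \<bullet> Y)"
    by (simp add: H0_selfadjoint[OF assms] matrix_mul_assoc[symmetric] H0_square[OF assms]
        matrix_mult_bilinear_simps)
  then have "norm (Y ** u) = sqrt (sl2_inner u u / 4 * (Y \<bullet> Y))"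
    by (simp only: norm_eq_sqrt_inner)
  then show ?thesis
    by (simp add: norm_eq_sqrt_inner real_sqrt_mult real_sqrt_divide)
qed

section \<open>Regularity of horizontal paths\<close>

text \<open>
  On the group this is the inverse. Being linear in the matrix, it makes the control
  \<open>u = adjugate2 \<gamma> \<gamma>'\<close> visibly continuous wherever the velocity is.
\<close>

definition adjugate2 :: "cmat2 \<Rightarrow> cmat2" where
  "adjugate2 g = vector [vector [g$2$2, - g$1$2], vector [- g$2$1, g$1$1]]"

lemma adjugate2_entries:
  "adjugate2 g $ 1 $ 1 = g$2$2" "adjugate2 g $ 1 $ 2 = - g$1$2"
  "adjugate2 g $ 2 $ 1 = - g$2$1" "adjugate2 g $ 2 $ 2 = g$1$1"
  by (simp_all add: adjugate2_def)

lemma adjugate2_inverse: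
  assumes "g \<in> SL2C"
  shows "g ** adjugate2 g = mat 1" "adjugate2 g ** g = mat 1"
  using assms
  by (simp_all add: SL2C_def det_2 cmat2_eq_iff matrix_mult_entry adjugate2_entries mat_def
      mult.commute)

lemma continuous_on_adjugate2:
  fixes f :: "'a::euclidean_space \<Rightarrow> cmat2"
  assumes "continuous_on S f"
  shows "continuous_on S (\<lambda>t. adjugate2 (f t))"
proof -
  have "linear adjugate2"
    by (rule linearI) (simp_all add: cmat2_eq_iff adjugate2_entries)
  then show ?thesis
    by (rule linear_continuous_on_compose[OF assms])
qed

lemma C1_piece_continuous: "C1_on_interval c d \<gamma> \<Longrightarrow> continuous_on {c..d} \<gamma>"
  unfolding C1_on_interval_def
  by (auto intro: continuous_on_vector_derivative)

text \<open>Away from finitely many parameters the control is forced by the path: it equals the continuous function \<open>adjugate2 \<gamma> D\<close>, where \<open>D\<close> is the derivative on the piece.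
  The two derivatives are compared at interior points, because one is taken relative to the
  piece and the other relative to the whole parameter interval.\<close>

lemma C1_piece_speed_integrable:
  assumes C1: "C1_on_interval c d \<gamma>" and sub: "{c..d} \<subseteq> {a..b}"
    and SL: "\<And>t. t \<in> {a..b} \<Longrightarrow> \<gamma> t \<in> SL2C"
    and H: "\<And>t. t \<in> {a..b} \<Longrightarrow> u t \<in> H0"
    and N: "finite N"
    and der: "\<And>t. t \<in> {a..b} - N \<Longrightarrow>
                (\<gamma> has_vector_derivative \<gamma> t ** u t) (at t within {a..b})"
  shows "(\<lambda>t. sqrt (sl2_inner (u t) (u t))) integrable_on {c..d}"
proof -
  obtain D where D: "continuous_on {c..d} D"
    "\<And>t. t \<in> {c..d} \<Longrightarrow> (\<gamma> has_vector_derivative D t) (at t within {c..d})"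
    using C1 unfolding C1_on_interval_def by blast
  let ?v = "\<lambda>t. adjugate2 (\<gamma> t) ** D t"
  have "continuous_on {c..d} ?v"
    by (intro bounded_bilinear.continuous_on[OF bounded_bilinear_matrix_mult]
        continuous_on_adjugate2 C1_piece_continuous[OF C1] D(1))
  then have int: "(\<lambda>t. sqrt 2 * norm (?v t)) integrable_on {c..d}"
    by (intro integrable_continuous_real continuous_intros)
  show ?thesis
  proof (rule integrable_spike_finite[OF _ _ int])
    show "finite (N \<union> {c, d})" using N by simp
  next
    fix t assume t: "t \<in> {c..d} - (N \<union> {c, d})"
    then have "c < t" "t < d" by auto
    have "(\<gamma> has_vector_derivative D t) (at t)"
      using D(2)[of t] t at_within_Icc_at[OF \<open>c < t\<close> \<open>t < d\<close>] by simp
    moreover have "(\<gamma> has_vector_derivative \<gamma> t ** u t) (at t)"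
      using has_vector_derivative_within_subset[OF der[of t] sub] t sub
        at_within_Icc_at[OF \<open>c < t\<close> \<open>t < d\<close>] by auto
    ultimately have "D t = \<gamma> t ** u t"
      by (rule vector_derivative_unique_at)
    then have "?v t = u t"
      using SL[of t] t sub by (auto simp: matrix_mul_assoc adjugate2_inverse(2))
    then show "sqrt (sl2_inner (u t) (u t)) = sqrt 2 * norm (?v t)"
      using sl2_inner_H0[OF H[of t]] t sub
      by (auto simp: real_sqrt_mult norm_eq_sqrt_inner)
  qed
qed

text \<open>Integrability of the speed makes the length a genuine integral: otherwise the integral would
  take the default value 0, and the length would bound nothing.\<close>

lemma horizontal_path_regularity:
  assumes "horizontal_path a b \<gamma> u"
  shows "a \<le> b" "continuous_on {a..b} \<gamma>"
    "(\<lambda>t. sqrt (sl2_inner (u t) (u t))) integrable_on {a..b}"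
proof -
  let ?g = "\<lambda>t. sqrt (sl2_inner (u t) (u t))"
  obtain n p where p: "p 0 = a" "p n = b"
    and piece: "\<And>i. i < n \<Longrightarrow> p i < p (Suc i) \<and> C1_on_interval (p i) (p (Suc i)) \<gamma>"
    using assms unfolding horizontal_path_def piecewise_C1_path_def by blast
  obtain N where N: "finite N"
    "\<And>t. t \<in> {a..b} - N \<Longrightarrow> (\<gamma> has_vector_derivative \<gamma> t ** u t) (at t within {a..b})"
    using assms unfolding horizontal_path_def by blast
  have mono: "p i \<le> p j" if "i \<le> j" "j \<le> n" for i j
    using that
  proof (induction j rule: dec_induct)
    case (step j)
    then show ?case using piece[of j] by fastforce
  qed simp
  have "continuous_on {a..p k} \<gamma> \<and> ?g integrable_on {a..p k}" if "k \<le> n" for k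
    using that
  proof (induction k)
    case 0
    then show ?case using integrable_on_refl[of ?g a] by (simp add: p)
  next
    case (Suc k)
    then have *: "a \<le> p k" "p k \<le> p (Suc k)" "p (Suc k) \<le> b"
      using mono[of 0 k] mono[of k "Suc k"] mono[of "Suc k" n] by (auto simp: p)
    have C1: "C1_on_interval (p k) (p (Suc k)) \<gamma>"
      using piece Suc by simp
    have "?g integrable_on {p k..p (Suc k)}"
      using C1 by (rule C1_piece_speed_integrable[where N = N and a = a and b = b])
        (use * N assms in \<open>auto simp: horizontal_path_def\<close>)
    then have "?g integrable_on {a..p (Suc k)}"
      using Suc.IH Suc.prems *
      by (intro Henstock_Kurzweil_Integration.integrable_combine[OF *(1,2)]) auto
    moreover have "continuous_on ({a..p k} \<union> {p k..p (Suc k)}) \<gamma>"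
      using Suc.IH Suc.prems C1_piece_continuous[OF C1]
      by (intro continuous_on_closed_Un) auto
    ultimately show ?case
      using ivl_disj_un_two_touch(4)[OF *(1,2)] by simp
  qed
  from this[of n] show "continuous_on {a..b} \<gamma>" "?g integrable_on {a..b}"
    by (auto simp: p)
  show "a \<le> b" using mono[of 0 n] by (simp add: p)
qed

section \<open>Length bounds the logarithmic growth of matrix norms\<close>

text \<open>The derivative of \<open>ln (Y \<bullet> Y)\<close> for \<open>Y = Q \<gamma>\<close> is \<open>2 (Y \<bullet> Y u) / (Y \<bullet> Y)\<close>, which is at most the
  speed since right multiplication by \<open>u\<close> stretches \<open>Y\<close> by half the speed.\<close>

lemma log_growth_le_length:
  fixes Q :: cmat2
  assumes hor: "horizontal_path a b \<gamma> u" and "Q \<noteq> 0"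
  shows "2 * ln (norm (Q ** \<gamma> b)) - 2 * ln (norm (Q ** \<gamma> a)) \<le> sr_length a b u"
proof -
  note reg = horizontal_path_regularity[OF hor]
  obtain N where N: "finite N"
    "\<And>t. t \<in> {a..b} - N \<Longrightarrow> (\<gamma> has_vector_derivative \<gamma> t ** u t) (at t within {a..b})"
    using hor unfolding horizontal_path_def by blast
  have SL: "\<And>t. t \<in> {a..b} \<Longrightarrow> \<gamma> t \<in> SL2C" and H: "\<And>t. t \<in> {a..b} \<Longrightarrow> u t \<in> H0"
    using hor unfolding horizontal_path_def by auto
  \<comment> \<open>The logarithm needs \<open>Y\<close> to stay away from 0, which holds because \<open>\<gamma>\<close> is invertible.\<close>
  define Y where "Y t = Q ** \<gamma> t" for t
  have Y_nz: "Y t \<noteq> 0" if "t \<in> {a..b}" for t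
  proof
    assume "Y t = 0"
    then have "Q ** (\<gamma> t ** adjugate2 (\<gamma> t)) = 0"
      by (simp add: Y_def matrix_mul_assoc)
    with \<open>Q \<noteq> 0\<close> show False
      by (simp add: adjugate2_inverse(1)[OF SL[OF that]])
  qed
  let ?F' = "\<lambda>t. 2 * (Y t \<bullet> (Y t ** u t)) / (Y t \<bullet> Y t)"
  have "(?F' has_integral ln (Y b \<bullet> Y b) - ln (Y a \<bullet> Y a)) {a..b}"
  proof (rule fundamental_theorem_of_calculus_interior_strong[OF N(1) reg(1)])
    fix t assume t: "t \<in> {a<..<b} - N"
    then have "(\<gamma> has_vector_derivative \<gamma> t ** u t) (at t)"
      using N(2)[of t] at_within_Icc_at[of a t b] by simp
    then have "(Y has_vector_derivative Y t ** u t) (at t)"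
      unfolding Y_def matrix_mul_assoc[symmetric]
      by (rule bounded_linear.has_vector_derivative
          [OF bounded_bilinear.bounded_linear_right[OF bounded_bilinear_matrix_mult]])
    then have "((\<lambda>t. Y t \<bullet> Y t) has_real_derivative 2 * (Y t \<bullet> (Y t ** u t))) (at t)"
      using bounded_bilinear.has_vector_derivative[OF bounded_bilinear_inner, of Y "Y t ** u t" t UNIV Y
        "Y t ** u t"]
      by (simp add: has_real_derivative_iff_has_vector_derivative inner_commute)
    then show "((\<lambda>t. ln (Y t \<bullet> Y t)) has_vector_derivative ?F' t) (at t)"
      using Y_nz[of t] t unfolding has_real_derivative_iff_has_vector_derivative[symmetric]
      by (auto intro!: derivative_eq_intros)
  next
    have "continuous_on {a..b} Y"
      unfolding Y_def
      by (intro bounded_bilinear.continuous_on[OF bounded_bilinear_matrix_mult]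
          continuous_intros reg(2))
    then show "continuous_on {a..b} (\<lambda>t. ln (Y t \<bullet> Y t))"
      using Y_nz by (intro continuous_intros) auto
  qed
  moreover have "((\<lambda>t. sqrt (sl2_inner (u t) (u t))) has_integral sr_length a b u) {a..b}"
    unfolding sr_length_def using reg(3) by (rule integrable_integral)
  moreover have "?F' t \<le> sqrt (sl2_inner (u t) (u t))" if "t \<in> {a..b}" for t
  proof -
    have "Y t \<bullet> (Y t ** u t) \<le> norm (Y t) * norm (Y t ** u t)"
      by (rule norm_cauchy_schwarz)
    also have "\<dots> = sqrt (sl2_inner (u t) (u t)) / 2 * (Y t \<bullet> Y t)"
      by (simp add: norm_mult_H0[OF H[OF that]] dot_square_norm power2_eq_square)
    finally show ?thesis
      using Y_nz[OF that] by (simp add: divide_le_eq)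
  qed
  ultimately have "ln (Y b \<bullet> Y b) - ln (Y a \<bullet> Y a) \<le> sr_length a b u"
    by (rule has_integral_le)
  moreover have "ln (Y t \<bullet> Y t) = 2 * ln (norm (Y t))" if "t \<in> {a..b}" for t
    using Y_nz[OF that] by (simp add: dot_square_norm ln_realpow)
  ultimately show ?thesis
    using reg(1) by (simp add: Y_def)
qed

section \<open>One-parameter subgroups with unit direction\<close>

text \<open>
  For a unit vector \<open>X\<close> of \<^term>\<open>H0\<close> these are the complementary spectral projections onto the
  eigenspaces of the eigenvalues \<open>1/2\<close> and \<open>-1/2\<close>.
\<close>

definition proj_plus :: "cmat2 \<Rightarrow> cmat2" where
  "proj_plus X = (1/2) *\<^sub>R mat 1 + X"

definition proj_minus :: "cmat2 \<Rightarrow> cmat2" where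
  "proj_minus X = (1/2) *\<^sub>R mat 1 - X"

context
  fixes X :: cmat2
  assumes X: "X \<in> H0" "sl2_inner X X = 1"
begin

lemma unit_H0_square: "X ** X = (1/4) *\<^sub>R mat 1"
  using H0_square[OF X(1)] X(2) by simp

lemma proj_eigen:
  "X ** proj_plus X = (1/2) *\<^sub>R proj_plus X" "X ** proj_minus X = (-1/2) *\<^sub>R proj_minus X"
  "proj_plus X ** X = (1/2) *\<^sub>R proj_plus X" "proj_minus X ** X = (-1/2) *\<^sub>R proj_minus X"
  by (simp_all add: proj_plus_def proj_minus_def matrix_mult_bilinear_simps unit_H0_square algebra_simps)

lemma proj_plus_idem: "proj_plus X ** proj_plus X = proj_plus X"
proof -
  have "proj_plus X ** proj_plus X = (1/2) *\<^sub>R proj_plus X + X ** proj_plus X"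
    by (subst (1) proj_plus_def) (simp add: matrix_mult_bilinear_simps)
  then show ?thesis
    by (simp add: proj_eigen flip: scaleR_left_distrib)
qed

lemma proj_plus_mult_minus: "proj_plus X ** proj_minus X = 0"
proof -
  have "proj_plus X ** proj_minus X = (1/2) *\<^sub>R proj_minus X + X ** proj_minus X"
    by (subst (1) proj_plus_def) (simp add: matrix_mult_bilinear_simps)
  then show ?thesis
    by (simp add: proj_eigen)
qed

text \<open>On each eigenspace the exponential series of \<open>\<tau> X\<close> is the scalar series at \<open>\<tau>/2\<close> or \<open>-\<tau>/2\<close>.\<close>

lemma mat_exp_unit_H0:
  "mat_exp (\<tau> *\<^sub>R X) = exp (\<tau>/2) *\<^sub>R proj_plus X + exp (-\<tau>/2) *\<^sub>R proj_minus X"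
proof -
  let ?P = "proj_plus X" and ?M = "proj_minus X"
  have pow: "((**) (\<tau> *\<^sub>R X) ^^ n) (mat 1) = (\<tau>/2)^n *\<^sub>R ?P + (-\<tau>/2)^n *\<^sub>R ?M" for n
  proof (induction n)
    case 0
    then show ?case by (simp add: proj_plus_def proj_minus_def flip: scaleR_left_distrib)
  next
    case (Suc n)
    then show ?case by (simp add: matrix_mult_bilinear_simps proj_eigen scaleR_right_diff_distrib)
  qed
  have "(\<lambda>n. (\<tau>/2)^n /\<^sub>R fact n) sums exp (\<tau>/2)" "(\<lambda>n. (-\<tau>/2)^n /\<^sub>R fact n) sums exp (-\<tau>/2)"
    by (rule exp_converges)+
  then have "(\<lambda>n. ((\<tau>/2)^n /\<^sub>R fact n) *\<^sub>R ?P + ((-\<tau>/2)^n /\<^sub>R fact n) *\<^sub>R ?M)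
      sums (exp (\<tau>/2) *\<^sub>R ?P + exp (-\<tau>/2) *\<^sub>R ?M)"
    by (intro sums_add bounded_linear.sums[OF bounded_linear_scaleR_left])
  then have "(\<lambda>n. (1 / fact n) *\<^sub>R (((**) (\<tau> *\<^sub>R X) ^^ n) (mat 1)))
      sums (exp (\<tau>/2) *\<^sub>R ?P + exp (-\<tau>/2) *\<^sub>R ?M)"
    by (simp only: pow scaleR_right_distrib scaleR_scaleR real_scaleR_def inverse_eq_divide)
  then show ?thesis
    unfolding mat_exp_def by (rule sums_unique[symmetric])
qed

lemma mat_exp_unit_H0_in_SL2C: "mat_exp (\<tau> *\<^sub>R X) \<in> SL2C"
proof -
  \<comment> \<open>In real coordinates the determinant is \<open>p q\<close>, the product of the eigenvalues.\<close>
  define x y z p q where "x = Re (X$1$1)" and "y = Re (X$1$2)" and "z = Im (X$1$2)"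
    and "p = exp (\<tau>/2)" and "q = exp (-\<tau>/2)"
  note defs = this
  have yz: "y\<^sup>2 + z\<^sup>2 = 1/4 - x\<^sup>2"
    using sl2_inner_H0[OF X(1)] X(2) H0_entries[OF X(1)]
    by (simp add: defs inner_cmat2 inner_complex_def power2_eq_square)
  have "p * q = 1"
    by (simp add: defs flip: exp_add)
  moreover have "(p * (1/2 + x) + q * (1/2 - x)) * (p * (1/2 - x) + q * (1/2 + x))
      - (p - q)\<^sup>2 * (y\<^sup>2 + z\<^sup>2) = p * q"
    unfolding yz by (simp add: power2_eq_square field_simps)
  ultimately have det: "(p * (1/2 + x) + q * (1/2 - x)) * (p * (1/2 - x) + q * (1/2 + x))
      - (p - q)\<^sup>2 * (y\<^sup>2 + z\<^sup>2) = 1"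
    by simp
  have X_eq: "X$1$1 = complex_of_real x" "X$2$2 = - complex_of_real x"
    "X$1$2 = Complex y z" "X$2$1 = Complex y (-z)"
    using H0_entries[OF X(1)] by (simp_all add: defs complex_eq_iff)
  show ?thesis
    unfolding SL2C_def mat_exp_unit_H0 proj_plus_def proj_minus_def defs(4,5)[symmetric]
    using det
    by (simp add: det_2 complex_eq_iff mat_def X_eq power2_eq_square algebra_simps)
qed

lemma mat_exp_unit_H0_derivative:
  "((\<lambda>\<tau>. mat_exp ((\<tau> + c) *\<^sub>R X)) has_vector_derivative mat_exp ((\<tau> + c) *\<^sub>R X) ** X) (at \<tau> within S)"
proof -
  have "mat_exp ((\<tau> + c) *\<^sub>R X) ** X
      = (1/2 * exp ((\<tau> + c)/2)) *\<^sub>R proj_plus X + (-1/2 * exp (-(\<tau> + c)/2)) *\<^sub>R proj_minus X"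
    unfolding mat_exp_unit_H0 by (simp add: matrix_mult_bilinear_simps proj_eigen)
  then show ?thesis
    unfolding mat_exp_unit_H0
    by (auto intro!: derivative_eq_intros
        simp: has_real_derivative_iff_has_vector_derivative[symmetric])
qed

lemma proj_plus_mult_mat_exp:
  "proj_plus X ** mat_exp (\<tau> *\<^sub>R X) = exp (\<tau>/2) *\<^sub>R proj_plus X"
  by (simp add: mat_exp_unit_H0 matrix_mult_bilinear_simps proj_plus_idem proj_plus_mult_minus)

lemma proj_plus_nonzero: "proj_plus X \<noteq> 0"
proof
  assume "proj_plus X = 0"
  then have "trace (proj_plus X) = 0" by (simp add: trace_def)
  then show False
    using H0_entries(1)[OF X(1)] by (simp add: proj_plus_def trace_def sum_2 mat_def)
qed

text \<open>The shift \<open>c\<close> serves both uses of the curve: \<open>c = 0\<close> gives the arc itself, and \<open>c = s\<close> its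
  reparametrisation to an interval starting at 0, as in the definition of the distance.\<close>

lemma horizontal_path_mat_exp:
  assumes "a \<le> b"
  shows "horizontal_path a b (\<lambda>\<tau>. mat_exp ((\<tau> + c) *\<^sub>R X)) (\<lambda>_. X)"
proof -
  let ?\<gamma> = "\<lambda>\<tau>. mat_exp ((\<tau> + c) *\<^sub>R X)"
  have "continuous_on {a..b} ?\<gamma>"
    using mat_exp_unit_H0_derivative by (rule continuous_on_vector_derivative)
  then have C1: "C1_on_interval a b ?\<gamma>"
    unfolding C1_on_interval_def
    by (intro exI[of _ "\<lambda>\<tau>. ?\<gamma> \<tau> ** X"] conjI ballI mat_exp_unit_H0_derivative
        bounded_bilinear.continuous_on[OF bounded_bilinear_matrix_mult] continuous_intros)
  have "piecewise_C1_path a b ?\<gamma>"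
  proof (cases "a = b")
    case True
    \<comment> \<open>A degenerate interval is subdivided into no pieces at all.\<close>
    then show ?thesis
      unfolding piecewise_C1_path_def by (intro exI[of _ 0] exI[of _ "\<lambda>_. a"]) simp
  next
    case False
    then show ?thesis
      unfolding piecewise_C1_path_def using C1 assms
      by (intro exI[of _ 1] exI[of _ "\<lambda>i. if i = 0 then a else b"]) auto
  qed
  then show ?thesis
    unfolding horizontal_path_def
    using X(1) mat_exp_unit_H0_in_SL2C mat_exp_unit_H0_derivative by blast
qed

lemma sr_length_unit_const: "a \<le> b \<Longrightarrow> sr_length a b (\<lambda>_. X) = b - a"
  by (simp add: sr_length_def X)

text \<open>The infimum is attained by the segment itself, and \<^term>\<open>proj_plus X\<close> is the choice of \<open>Q\<close> for
  which the lower bound \<open>log_growth_le_length\<close> has the same value.\<close>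

lemma sr_dist_mat_exp:
  assumes "s \<le> t"
  shows "sr_dist (mat_exp (s *\<^sub>R X)) (mat_exp (t *\<^sub>R X)) = t - s"
  unfolding sr_dist_def
proof (rule cInf_eq_minimum)
  show "t - s \<in> {sr_length 0 a u | a \<gamma> u. horizontal_path 0 a \<gamma> u \<and>
      \<gamma> 0 = mat_exp (s *\<^sub>R X) \<and> \<gamma> a = mat_exp (t *\<^sub>R X)}"
    using assms horizontal_path_mat_exp[of 0 "t - s" s] sr_length_unit_const[of 0 "t - s"]
    by (intro CollectI exI[of _ "t - s"] exI[of _ "\<lambda>\<tau>. mat_exp ((\<tau> + s) *\<^sub>R X)"]
        exI[of _ "\<lambda>_. X"]) auto
next
  fix l assume "l \<in> {sr_length 0 a u | a \<gamma> u. horizontal_path 0 a \<gamma> u \<and>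
      \<gamma> 0 = mat_exp (s *\<^sub>R X) \<and> \<gamma> a = mat_exp (t *\<^sub>R X)}"
  then obtain a \<gamma> u where l: "l = sr_length 0 a u" "horizontal_path 0 a \<gamma> u"
    "\<gamma> 0 = mat_exp (s *\<^sub>R X)" "\<gamma> a = mat_exp (t *\<^sub>R X)"
    by blast
  have "ln (norm (proj_plus X ** mat_exp (r *\<^sub>R X))) = r/2 + ln (norm (proj_plus X))" for r
    using proj_plus_nonzero by (simp add: proj_plus_mult_mat_exp ln_mult)
  then show "t - s \<le> l"
    using log_growth_le_length[OF l(2) proj_plus_nonzero] by (simp add: l)
qed

end

theorem theorem4:
  fixes X :: cmat2 and s t :: real
  assumes "X \<in> H0" and "sl2_inner X X = 1" and "s \<le> t"
  shows "shortest_arc s t (\<lambda>\<tau>. mat_exp (\<tau> *\<^sub>R X))"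
  unfolding shortest_arc_def
  using horizontal_path_mat_exp[OF assms, of 0] sr_length_unit_const[OF assms]
    sr_dist_mat_exp[OF assms]
  by auto

end
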